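(* Let $G$ be any group. Then $R_G(G)$, the radius of $G$ in $G$, equals the rank of $G$ (the minimal cardinality of a generating set of $G$, taken to be $\infty$ if $G$ is not finitely generated).
   Context: For a group $G$ and a subgroup $H$, let $\chi_H\colon G\to\{0,1\}$ be the characteristic function of $H$, and let $A_G$ be the set of characteristic functions of all subgroups of $G$, partially ordered by equality. For $S\subseteq G$, $\chi_H$ is Occam on $S$ if $\chi_H$ is the only element of $A_G$ agreeing with $\chi_H$ on $S$. The radius $R_G(H)$ is $\min\{|S| : S\subseteq G,\ \chi_H \text{ is Occam on } S\}$ if this is finite, and $\infty$ otherwise. *)

theory Defs
  imports
    "HOL-Algebra.Generated_Groups"
    "HOL-Library.Extended_Nat"
    "HOL-Library.Indicator_Function"
begin

text \<open>
  Functions on the carrier are represented extensionally, so that HOL equality of members of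
  \<open>subgroup_chars G\<close> is equality as functions on \<open>carrier G\<close>.
\<close>

definition char_fun :: "('a, 'b) monoid_scheme \<Rightarrow> 'a set \<Rightarrow> 'a \<Rightarrow> nat" where
  "char_fun G H = restrict (indicator H) (carrier G)"

definition subgroup_chars :: "('a, 'b) monoid_scheme \<Rightarrow> ('a \<Rightarrow> nat) set" where
  "subgroup_chars G = {char_fun G H | H. subgroup H G}"

text \<open>
  The order on \<open>subgroup_chars G\<close> is equality, so being Occam means being the only member with
  the given values on \<open>S\<close>.
\<close>

definition occam_on :: "('a, 'b) monoid_scheme \<Rightarrow> 'a set \<Rightarrow> 'a set \<Rightarrow> bool" where
  "occam_on G H S \<longleftrightarrow>
     {f \<in> subgroup_chars G. \<forall>x\<in>S. f x = char_fun G H x} = {char_fun G H}"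

text \<open>
  Infinite sets would contribute \<open>\<infinity>\<close> to the minima below. They are excluded because \<open>card\<close> is
  \<open>0\<close> on them, and \<open>Inf {} = \<infinity>\<close> in \<^typ>\<open>enat\<close> covers the case where no finite set qualifies.
\<close>

definition radius :: "('a, 'b) monoid_scheme \<Rightarrow> 'a set \<Rightarrow> enat" where
  "radius G H = Inf {enat (card S) | S. S \<subseteq> carrier G \<and> finite S \<and> occam_on G H S}"

definition group_rank :: "('a, 'b) monoid_scheme \<Rightarrow> enat" where
  "group_rank G = Inf {enat (card S) | S. S \<subseteq> carrier G \<and> finite S \<and> generate G S = carrier G}"

end

theory Submission
  imports Defs
begin

text \<open>The function of \<open>carrier G\<close> is constantly 1, so the function of a subgroup
  H agrees with it on S exactly when S lies in H. Hence \<open>carrier G\<close> is Occam on S iff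
  no proper subgroup contains S, that is, iff S generates G
  (\<open>occam_on_carrier_iff_generate\<close>). Radius and rank are then infima of the same set,
  also when it is empty and both are \<infinity>.\<close>

lemma char_fun_inject:
  assumes "H \<subseteq> carrier G" "K \<subseteq> carrier G"
  shows "char_fun G H = char_fun G K \<longleftrightarrow> H = K"
proof
  assume eq: "char_fun G H = char_fun G K"
  have "x \<in> H \<longleftrightarrow> x \<in> K" if "x \<in> carrier G" for x
    using fun_cong[OF eq, of x] that by (simp add: char_fun_def indicator_def of_bool_eq_iff)
  then show "H = K"
    using assms by blast
qed simp

lemma char_fun_agree_carrier_iff:
  assumes "S \<subseteq> carrier G"
  shows "(\<forall>x\<in>S. char_fun G H x = char_fun G (carrier G) x) \<longleftrightarrow> S \<subseteq> H"
  using assms by (auto simp: char_fun_def indicator_def subset_iff split: if_splits)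

lemma (in group) occam_on_carrier_iff_supergroup:
  assumes "S \<subseteq> carrier G"
  shows "occam_on G (carrier G) S \<longleftrightarrow> (\<forall>H. subgroup H G \<and> S \<subseteq> H \<longrightarrow> H = carrier G)"
proof -
  have "{f \<in> subgroup_chars G. \<forall>x\<in>S. f x = char_fun G (carrier G) x}
      = char_fun G ` {H. subgroup H G \<and> S \<subseteq> H}"
    using char_fun_agree_carrier_iff[OF assms] by (auto simp: subgroup_chars_def)
  \<comment> \<open>Occam asks for equality with a singleton, so the function of
    \<open>carrier G\<close> must itself be among the candidates.\<close>
  moreover have "carrier G \<in> {H. subgroup H G \<and> S \<subseteq> H}"
    using assms subgroup_self by simp
  moreover have "char_fun G H = char_fun G (carrier G) \<longleftrightarrow> H = carrier G" if "subgroup H G" for H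
    using char_fun_inject[OF subgroup.subset[OF that] order_refl] .
  ultimately show ?thesis
    unfolding occam_on_def by blast
qed

text \<open>\<open>generate G S\<close> is the least subgroup containing S: it serves as H in one
  direction and lies below every such H in the other.\<close>

lemma (in group) occam_on_carrier_iff_generate:
  assumes "S \<subseteq> carrier G"
  shows "occam_on G (carrier G) S \<longleftrightarrow> generate G S = carrier G"
  unfolding occam_on_carrier_iff_supergroup[OF assms]
proof (intro iffI allI impI)
  assume "\<forall>H. subgroup H G \<and> S \<subseteq> H \<longrightarrow> H = carrier G"
  then show "generate G S = carrier G"
    using generate_is_subgroup[OF assms] generate.incl[of _ S G] by blast
next
  fix H assume "generate G S = carrier G" "subgroup H G \<and> S \<subseteq> H"
  then show "H = carrier G"
    using generate_subgroup_incl[of S H] subgroup.subset[of H G] by blast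
qed

theorem theorem2p1:
  fixes G :: "('a, 'b) monoid_scheme"
  assumes "group G"
  shows "radius G (carrier G) = group_rank G"
  unfolding radius_def group_rank_def
  \<comment> \<open>Both sets require S to lie in the carrier, which is what the equivalence
    needs.\<close>
  using group.occam_on_carrier_iff_generate[OF assms] by (metis (no_types, lifting))

end
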